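(* Discrete flat surfaces in $\mathbb{H}^3$ have concircular quadrilaterals. That is, let $g:D\to\mathbb{C}$ be a discrete holomorphic function with cross ratio factorizing function $\alpha$, let $\lambda\in\mathbb{R}\setminus\{0\}$, and let $E$ be a lift on $D$, with $\det E_p>0$ for all $p$, satisfying $$E_q-E_p=E_p\begin{pmatrix}0& g_q-g_p\\ \frac{\lambda\alpha_{pq}}{g_q-g_p}&0\end{pmatrix}.$$ Let $f_{0,p}=\frac{1}{\det E_p}E_p\overline{E_p}^T\in\mathbb{H}^3$. Then for every unit square of $D$ with vertices $p=(m,n)$, $q=(m+1,n)$, $r=(m+1,n+1)$, $s=(m,n+1)$, the four points $f_{0,p},f_{0,q},f_{0,r},f_{0,s}$ are concircular.
   Context: Domain and discrete holomorphic functions: $D$ is $\mathbb{Z}^2$ or a subdomain of it. A map $g:D\to\mathbb{C}$, with $g_q\neq g_p$ for all adjacent $p,q\in D$, is discrete holomorphic if there is a real-valued function $\alpha$ on the (unoriented) edges of $D$, called a cross ratio factorizing function, such that on each unit square $\frac{(g_{m+1,n}-g_{m,n})(g_{m,n+1}-g_{m+1,n+1})}{(g_{m+1,n+1}-g_{m+1,n})(g_{m,n}-g_{m,n+1})}=\frac{\alpha_{(m,n)(m+1,n)}}{\alpha_{(m,n)(m,n+1)}}<0$, with $\alpha_{(m,n)(m+1,n)}=\alpha_{(m,n+1)(m+1,n+1)}$ and $\alpha_{(m,n)(m,n+1)}=\alpha_{(m+1,n)(m+1,n+1)}$. Hyperbolic space: $\mathbb{R}^{3,1}$ (metric $-dx_0^2+dx_1^2+dx_2^2+dx_3^2$)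 is identified with Hermitian $2\times2$ matrices $\begin{pmatrix} x_0+x_3 & x_1+ix_2\\ x_1-ix_2& x_0-x_3\end{pmatrix}$, and $\mathbb{H}^3$ is the set of such $X$ with $\det X=1$, $\mathrm{tr}\,X>0$. Discrete flat surfaces: the equation for the $2\times2$ complex matrices $E_p$ is imposed for edges $pq$ with $q=p+(1,0)$ or $q=p+(0,1)$ (traversing an edge in the reverse direction changes $E$ only by a real scalar factor, which does not affect $f_0$). A map $f_0$ obtained from such $E$ is called a discrete flat surface. Concircular: points of $\mathbb{H}^3$ are concircular if they lie on a common circle in the Möbius-geometric sense, i.e. a circle or straight line in the conformal (Poincaré) ball model; equivalently, the points lie in a common affine $2$-plane of $\mathbb{R}^{3,1}$. *)

theory Defs
  imports "HOL-Analysis.Analysis"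
begin

subsection \<open>Discrete holomorphic functions\<close>

type_synonym vertex = "int \<times> int"

text \<open>A domain is given by its set of vertices \<open>D\<close>; the edges and unit squares of \<open>D\<close> are those of
  the square lattice all of whose vertices lie in \<open>D\<close>. An unoriented edge is the set of its two end
  points, so a function on edges has type \<open>vertex set \<Rightarrow> real\<close>; its values at sets
  that are not edges of \<open>D\<close> play no role.\<close>

definition dir_edge :: "vertex set \<Rightarrow> vertex \<Rightarrow> vertex \<Rightarrow> bool" where
  "dir_edge D p q \<longleftrightarrow> p \<in> D \<and> q \<in> D \<and> (q = p + (1, 0) \<or> q = p + (0, 1))"

definition adjacent_in :: "vertex set \<Rightarrow> vertex \<Rightarrow> vertex \<Rightarrow> bool" where
  "adjacent_in D p q \<longleftrightarrow> dir_edge D p q \<or> dir_edge D q p"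

definition unit_square_in :: "vertex set \<Rightarrow> int \<Rightarrow> int \<Rightarrow> bool" where
  "unit_square_in D m n \<longleftrightarrow> {(m, n), (m + 1, n), (m + 1, n + 1), (m, n + 1)} \<subseteq> D"

definition cross_ratio :: "complex \<Rightarrow> complex \<Rightarrow> complex \<Rightarrow> complex \<Rightarrow> complex" where
  "cross_ratio gp gq gr gs = ((gq - gp) * (gs - gr)) / ((gr - gq) * (gp - gs))"

definition cross_ratio_factorizing ::
  "vertex set \<Rightarrow> (vertex \<Rightarrow> complex) \<Rightarrow> (vertex set \<Rightarrow> real) \<Rightarrow> bool" where
  "cross_ratio_factorizing D g \<alpha> \<longleftrightarrow>
    (\<forall>m n. unit_square_in D m n \<longrightarrow>
      cross_ratio (g (m, n)) (g (m + 1, n)) (g (m + 1, n + 1)) (g (m, n + 1)) =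
        complex_of_real (\<alpha> {(m, n), (m + 1, n)} / \<alpha> {(m, n), (m, n + 1)}) \<and>
      \<alpha> {(m, n), (m + 1, n)} / \<alpha> {(m, n), (m, n + 1)} < 0 \<and>
      \<alpha> {(m, n), (m + 1, n)} = \<alpha> {(m, n + 1), (m + 1, n + 1)} \<and>
      \<alpha> {(m, n), (m, n + 1)} = \<alpha> {(m + 1, n), (m + 1, n + 1)})"

definition discrete_holomorphic_with ::
  "vertex set \<Rightarrow> (vertex \<Rightarrow> complex) \<Rightarrow> (vertex set \<Rightarrow> real) \<Rightarrow> bool" where
  "discrete_holomorphic_with D g \<alpha> \<longleftrightarrow>
    (\<forall>p q. adjacent_in D p q \<longrightarrow> g q \<noteq> g p) \<and> cross_ratio_factorizing D g \<alpha>"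

subsection \<open>Hyperbolic space\<close>

definition mat22 :: "'a::zero \<Rightarrow> 'a \<Rightarrow> 'a \<Rightarrow> 'a \<Rightarrow> 'a^2^2" where
  "mat22 a b c d = vector [vector [a, b], vector [c, d]]"

definition conj_transpose :: "complex^2^2 \<Rightarrow> complex^2^2" where
  "conj_transpose A = (\<chi> i j. cnj (A $ j $ i))"

definition hermitian :: "complex^2^2 \<Rightarrow> bool" where
  "hermitian X \<longleftrightarrow> conj_transpose X = X"

text \<open>The Hermitian matrix of a point of Minkowski space, written as the pair of its
  time coordinate \<open>x0\<close> and its space coordinates \<open>(x1, x2, x3)\<close>.\<close>

definition herm_of :: "real \<times> (real^3) \<Rightarrow> complex^2^2" where
  "herm_of = (\<lambda>(x0, x). mat22
      (complex_of_real (x0 + x $ 3)) (Complex (x $ 1) (x $ 2))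
      (Complex (x $ 1) (- x $ 2)) (complex_of_real (x0 - x $ 3)))"

definition time_coord :: "complex^2^2 \<Rightarrow> real" where
  "time_coord X = Re (X $ 1 $ 1 + X $ 2 $ 2) / 2"

definition space_coords :: "complex^2^2 \<Rightarrow> real^3" where
  "space_coords X = vector [Re (X $ 1 $ 2), Im (X $ 1 $ 2), Re (X $ 1 $ 1 - X $ 2 $ 2) / 2]"

lemma coords_herm_of:
  "time_coord (herm_of (x0, x)) = x0" "space_coords (herm_of (x0, x)) = x"
  by (auto simp: time_coord_def space_coords_def herm_of_def mat22_def vec_eq_iff forall_3)

lemma herm_of_coords:
  assumes "hermitian X"
  shows "herm_of (time_coord X, space_coords X) = X"
proof -
  have "cnj (X $ j $ i) = X $ i $ j" for i j
    using arg_cong[OF assms[unfolded hermitian_def], of "\<lambda>A. A $ i $ j"]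
    by (simp add: conj_transpose_def)
  from this[of 1 1] this[of 2 2] this[of 2 1] show ?thesis
    by (auto simp: time_coord_def space_coords_def herm_of_def mat22_def vec_eq_iff forall_2
        complex_eq_iff field_simps)
qed

lemma hermitian_herm_of: "hermitian (herm_of v)"
  by (cases v) (auto simp: hermitian_def conj_transpose_def herm_of_def mat22_def vec_eq_iff
      forall_2 complex_eq_iff)

lemma det_herm_of: "det (herm_of (x0, x)) = complex_of_real (x0\<^sup>2 - x \<bullet> x)"
  by (simp add: det_2 herm_of_def mat22_def inner_vec_def sum_3 complex_eq_iff
      power2_eq_square algebra_simps)

text \<open>The trace of a Hermitian matrix is real, so its positivity is that of its real part.\<close>

definition hyperbolic_space :: "(complex^2^2) set" where
  "hyperbolic_space = {X. hermitian X \<and> det X = 1 \<and> Re (trace X) > 0}"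

text \<open>Central projection from \<open>(-1, 0)\<close> to the hyperplane \<open>x0 = 0\<close>, which maps
  hyperbolic space to the open unit ball.\<close>

definition poincare_ball :: "complex^2^2 \<Rightarrow> real^3" where
  "poincare_ball X = space_coords X /\<^sub>R (1 + time_coord X)"

definition euclidean_circle :: "(real^3) set \<Rightarrow> bool" where
  "euclidean_circle C \<longleftrightarrow>
    (\<exists>P c r. affine P \<and> aff_dim P = 2 \<and> c \<in> P \<and> r > 0 \<and> C = P \<inter> sphere c r)"

definition straight_line :: "(real^3) set \<Rightarrow> bool" where
  "straight_line C \<longleftrightarrow> affine C \<and> aff_dim C = 1"

definition concircular :: "(complex^2^2) set \<Rightarrow> bool" where
  "concircular S \<longleftrightarrow> S \<subseteq> hyperbolic_space \<and>
    (\<exists>C. (euclidean_circle C \<or> straight_line C) \<and> poincare_ball ` S \<subseteq> C)"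

subsection \<open>Discrete flat surfaces\<close>

text \<open>The matrix equation is imposed in the positive lattice directions only. In the positivity
  condition the determinant, a complex number, is required to be real and positive.\<close>

definition flat_lift ::
  "vertex set \<Rightarrow> (vertex \<Rightarrow> complex) \<Rightarrow> (vertex set \<Rightarrow> real) \<Rightarrow> real \<Rightarrow>
    (vertex \<Rightarrow> complex^2^2) \<Rightarrow> bool" where
  "flat_lift D g \<alpha> lam E \<longleftrightarrow>
    (\<forall>p\<in>D. det (E p) \<in> \<real> \<and> Re (det (E p)) > 0) \<and>
    (\<forall>p q. dir_edge D p q \<longrightarrow>
      E q - E p = E p ** mat22 0 (g q - g p)
        (complex_of_real (lam * \<alpha> {p, q}) / (g q - g p)) 0)"

definition flat_surface :: "(vertex \<Rightarrow> complex^2^2) \<Rightarrow> vertex \<Rightarrow> complex^2^2" where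
  "flat_surface E p = map_matrix (\<lambda>z. z / det (E p)) (E p ** conj_transpose (E p))"

end

theory Submission
  imports Defs
begin

text \<open>Write \<open>a = g q - g p\<close>, \<open>A = \<lambda> \<alpha>\<^bsub>pq\<^esub>\<close>, \<open>b = g s - g p\<close>, \<open>B = \<lambda> \<alpha>\<^bsub>ps\<^esub>\<close>. After the isometry that
  moves \<open>f\<^sub>0\<close> at \<open>p\<close> to the identity matrix, \<open>f\<^sub>0\<close> at \<open>q\<close> and \<open>s\<close> differs from it by real multiples of
  the Hermitian matrices with rows \<open>(\<bar>a\<bar>\<^sup>2, a)\<close>, \<open>(cnj a, A)\<close> and \<open>(\<bar>b\<bar>\<^sup>2, b)\<close>, \<open>(cnj b, B)\<close>.
  The cross ratio condition makes the difference at \<open>r\<close> a real linear combination of the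
  same two matrices, so the four points lie in an affine plane of Minkowski space of dimension at
  most two. In the ball model an affine hyperplane of Minkowski space becomes a generalised sphere,
  and two independent hyperplanes containing the four points give a circle or a line.\<close>

section \<open>Circles and lines in the ball model\<close>

text \<open>Covers the degenerate cases below: circles have positive radius, so an empty set or a
  single point is placed on a line.\<close>

lemma straight_line_through: "\<exists>C. straight_line C \<and> c \<in> C"
proof (intro exI conjI)
  let ?C = "affine hull {c, c + axis 1 1}"
  show "straight_line ?C"
    by (simp add: straight_line_def aff_dim_2 axis_eq_0_iff)
  show "c \<in> ?C" by (simp add: hull_inc)
qed

text \<open>The part \<open>y\<close> of \<open>w\<close> orthogonal to \<open>v\<close> is a
  direction of the first plane, so \<open>w\<close> is constant along it and \<open>y\<close>
  vanishes.\<close>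

lemma plane_subset_plane_imp_proportional:
  fixes v w :: "'a::euclidean_space"
  assumes v: "v \<noteq> 0" and sub: "{x. v \<bullet> x = b} \<subseteq> {x. w \<bullet> x = c}"
  shows "\<exists>t. w = t *\<^sub>R v \<and> c = t * b"
proof -
  define t where "t = (v \<bullet> w) / (v \<bullet> v)"
  define x where "x = (b / (v \<bullet> v)) *\<^sub>R v"
  define y where "y = w - t *\<^sub>R v"
  have vv: "v \<bullet> v \<noteq> 0" using v by simp
  have vx: "v \<bullet> x = b" using vv by (simp add: x_def)
  have vy: "v \<bullet> y = 0" using vv by (simp add: y_def t_def inner_diff_right)
  have wx: "w \<bullet> x = c" using sub vx by auto
  have "v \<bullet> (x + y) = b" using vx vy by (simp add: inner_add_right)
  then have "w \<bullet> (x + y) = c" using sub by blast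
  then have "w \<bullet> y = 0" using wx by (simp add: inner_add_right)
  then have "y \<bullet> y = 0" using vy by (subst (1) y_def) (simp add: inner_diff_left)
  then have "w = t *\<^sub>R v" by (simp add: y_def)
  moreover have "c = t * b" using wx vx calculation by auto
  ultimately show ?thesis by blast
qed

text \<open>The centre of the circle is the foot \<open>c\<close> of the perpendicular from
  \<open>z\<close> to the plane; by Pythagoras all points of \<open>U\<close> have the same distance
  from \<open>c\<close>.\<close>

lemma sphere_Int_plane_subset_circle_or_line:
  fixes U :: "(real^3) set"
  assumes v: "v \<noteq> 0" and plane: "\<And>u. u \<in> U \<Longrightarrow> v \<bullet> u = b"
    and sphere: "\<And>u. u \<in> U \<Longrightarrow> norm (u - z) = \<rho>"
  shows "\<exists>C. (euclidean_circle C \<or> straight_line C) \<and> U \<subseteq> C"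
proof (cases "U = {}")
  case True
  then show ?thesis using straight_line_through by blast
next
  case False
  then obtain u0 where u0: "u0 \<in> U" by blast
  define c where "c = z - ((v \<bullet> z - b) / (v \<bullet> v)) *\<^sub>R v"
  have vv: "v \<bullet> v \<noteq> 0" using v by simp
  have vc: "v \<bullet> c = b" using vv by (simp add: c_def inner_diff_right)
  have "(norm (u - c))\<^sup>2 = \<rho>\<^sup>2 - (norm (c - z))\<^sup>2" if u: "u \<in> U" for u
  proof -
    have "v \<bullet> (u - c) = 0" using plane[OF u] vc by (simp add: inner_diff_right)
    then have "orthogonal (u - c) (c - z)"
      by (simp add: orthogonal_def c_def inner_commute)
    from norm_add_Pythagorean[OF this] show ?thesis using sphere[OF u] by simp
  qed
  then have "(norm (u - c))\<^sup>2 = (norm (u0 - c))\<^sup>2" if "u \<in> U" for u using u0 that by simp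
  then have dist: "dist c u = dist c u0" if "u \<in> U" for u
    using that by (simp add: dist_norm norm_minus_commute[of c] power2_eq_iff_nonneg)
  show ?thesis
  proof (cases "dist c u0 = 0")
    case True
    then have "U \<subseteq> {c}" using dist by auto
    then show ?thesis using straight_line_through[of c] by blast
  next
    case False
    then have "euclidean_circle ({x. v \<bullet> x = b} \<inter> sphere c (dist c u0))"
      unfolding euclidean_circle_def using vc v
      by (intro exI[of _ "{x. v \<bullet> x = b}"] exI[of _ c] exI[of _ "dist c u0"])
        (auto simp: affine_hyperplane aff_dim_hyperplane)
    moreover have "U \<subseteq> {x. v \<bullet> x = b} \<inter> sphere c (dist c u0)"
      using plane dist by auto
    ultimately show ?thesis by blast
  qed
qed

section \<open>Affine hyperplanes of Minkowski space in the ball model\<close>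

lemma exists_orthogonal_to_three:
  fixes x y z :: "real \<times> (real^3)"
  obtains w where "w \<noteq> 0" "w \<bullet> x = 0" "w \<bullet> y = 0" "w \<bullet> z = 0"
proof -
  have "dim (span {x, y, z}) \<le> card {x, y, z}" by (simp add: dim_le_card')
  also have "\<dots> \<le> 3" by (simp add: card_insert_if)
  also have "\<dots> < DIM(real \<times> (real^3))" by simp
  finally obtain w where "w \<noteq> 0" "\<And>v. v \<in> span (span {x, y, z}) \<Longrightarrow> orthogonal w v"
    using orthogonal_to_subspace_exists[of "span {x, y, z}"] by (metis span_span)
  then show ?thesis using that[of w] by (simp add: orthogonal_def span_base)
qed

definition coords :: "complex^2^2 \<Rightarrow> real \<times> (real^3)" where
  "coords X = (time_coord X, space_coords X)"

lemma linear_coords: "linear coords"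
  by (rule linearI) (auto simp: coords_def time_coord_def space_coords_def vec_eq_iff
      forall_3 algebra_simps add_divide_distrib diff_divide_distrib)

lemma hyperbolic_space_coords:
  assumes "X \<in> hyperbolic_space"
  shows "time_coord X > 0" "space_coords X \<bullet> space_coords X = (time_coord X)\<^sup>2 - 1"
proof -
  have h: "hermitian X" "det X = 1" "Re (trace X) > 0"
    using assms by (auto simp: hyperbolic_space_def)
  show "time_coord X > 0" using h(3) by (simp add: time_coord_def trace_def sum_2)
  have "complex_of_real ((time_coord X)\<^sup>2 - space_coords X \<bullet> space_coords X) = 1"
    using det_herm_of[of "time_coord X" "space_coords X"] herm_of_coords[OF h(1)] h(2) by simp
  then have "(time_coord X)\<^sup>2 - space_coords X \<bullet> space_coords X = 1"
    by (metis of_real_eq_1_iff)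
  then show "space_coords X \<bullet> space_coords X = (time_coord X)\<^sup>2 - 1" by simp
qed

text \<open>The projection has the inverse \<open>t = (1 + |u|^2) / (1 - |u|^2)\<close>,
  \<open>x = 2 u / (1 - |u|^2)\<close>. Inserting this in \<open>h t + v x = l\<close> and clearing
  the denominator gives the equation.\<close>

lemma hyperplane_in_poincare_ball:
  assumes X: "X \<in> hyperbolic_space" and N: "(h, v) \<bullet> coords X = l"
  shows "(h + l) * (poincare_ball X \<bullet> poincare_ball X) + 2 * (v \<bullet> poincare_ball X) + (h - l) = 0"
proof -
  note * = hyperbolic_space_coords[OF X]
  define t x where "t = time_coord X" and "x = space_coords X"
  have t: "1 + t > 0" and xx: "x \<bullet> x = t\<^sup>2 - 1" and hv: "h * t + v \<bullet> x = l"
    using * N by (auto simp: t_def x_def coords_def)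
  have u: "poincare_ball X = x /\<^sub>R (1 + t)" by (simp add: poincare_ball_def t_def x_def)
  have uu: "poincare_ball X \<bullet> poincare_ball X = (t - 1) / (1 + t)"
  proof -
    have "poincare_ball X \<bullet> poincare_ball X = (x \<bullet> x) / (1 + t)\<^sup>2"
      by (simp add: u divide_inverse power2_eq_square)
    also have "\<dots> = ((1 + t) * (t - 1)) / ((1 + t) * (1 + t))"
      by (simp add: xx power2_eq_square algebra_simps)
    finally show ?thesis using t by simp
  qed
  have vu: "v \<bullet> poincare_ball X = (l - h * t) / (1 + t)"
    using t hv by (simp add: u field_simps)
  have "(h + l) * (t - 1) + 2 * (l - h * t) + (h - l) * (1 + t) = 0" by algebra
  then have "((h + l) * (t - 1) + 2 * (l - h * t) + (h - l) * (1 + t)) / (1 + t) = 0" by simp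
  then show ?thesis using t unfolding uu vu by (simp add: add_divide_distrib)
qed

text \<open>The first hyperplane is chosen so that the quadratic term of its generalised sphere
  vanishes, the second one so that its normal is orthogonal to that of the first.\<close>

lemma concircular_if_coplanar:
  assumes S: "S \<subseteq> hyperbolic_space" and X0: "X0 \<in> S"
    and span: "\<And>X. X \<in> S \<Longrightarrow> X - X0 \<in> span {V, W}"
  shows "concircular S"
proof -
  \<comment> \<open>The third vector is \<open>coords X0\<close> minus the projection centre
    \<open>(-1, 0)\<close>: the hyperplane with normal \<open>N\<close> through the points of
    \<open>S\<close> also contains the centre, so it projects to a plane.\<close>
  obtain N where N: "N \<noteq> 0" "N \<bullet> coords V = 0" "N \<bullet> coords W = 0" "N \<bullet> (coords X0 + (1, 0)) = 0"
    by (rule exists_orthogonal_to_three)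
  obtain M where M: "M \<noteq> 0" "M \<bullet> coords V = 0" "M \<bullet> coords W = 0" "M \<bullet> N = 0"
    by (rule exists_orthogonal_to_three)
  obtain h v where hv: "N = (h, v)" by (cases N)
  obtain k w where kw: "M = (k, w)" by (cases M)
  have const: "L \<bullet> coords X = L \<bullet> coords X0"
    if "L \<bullet> coords V = 0" "L \<bullet> coords W = 0" "X \<in> S" for L X
  proof -
    have "coords X - coords X0 \<in> span (coords ` {V, W})"
      using span[OF that(3)] linear_coords
      by (metis imageI linear_diff linear_span_image)
    then have "orthogonal L (coords X - coords X0)"
      by (rule orthogonal_to_span) (use that in \<open>auto simp: orthogonal_def\<close>)
    then show ?thesis by (simp add: orthogonal_def inner_diff_right)
  qed
  have Nl: "N \<bullet> coords X0 = - h" using N(4) by (simp add: hv inner_add_right)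
  define l where "l = M \<bullet> coords X0"
  let ?U = "poincare_ball ` S"
  have plane: "v \<bullet> u = - h" if u: "u \<in> ?U" for u
  proof -
    obtain X where X: "X \<in> S" "u = poincare_ball X" using u by blast
    have "(h, v) \<bullet> coords X = - h" using const[OF N(2,3) X(1)] Nl hv by simp
    from hyperplane_in_poincare_ball[OF _ this] show ?thesis using X S by auto
  qed
  have sph: "(k + l) * (u \<bullet> u) + 2 * (w \<bullet> u) + (k - l) = 0" if u: "u \<in> ?U" for u
  proof -
    obtain X where X: "X \<in> S" "u = poincare_ball X" using u by blast
    have "(k, w) \<bullet> coords X = l" using const[OF M(2,3) X(1)] kw l_def by simp
    from hyperplane_in_poincare_ball[OF _ this] show ?thesis using X S by auto
  qed
  have v: "v \<noteq> 0"
  proof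
    assume "v = 0"
    then have "h = 0" using plane X0 by fastforce
    then show False using N(1) hv \<open>v = 0\<close> by (simp add: zero_prod_def)
  qed
  have "\<exists>C. (euclidean_circle C \<or> straight_line C) \<and> ?U \<subseteq> C"
  proof (cases "k + l = 0")
    case True
    then have plane2: "w \<bullet> u = - k" if "u \<in> ?U" for u using sph[OF that] by simp
    let ?C = "{x. v \<bullet> x = - h} \<inter> {x. w \<bullet> x = - k}"
    have sub: "?U \<subseteq> ?C" using plane plane2 by blast
    \<comment> \<open>Otherwise \<open>M\<close> would be a multiple of \<open>N\<close>, impossible
      for a nonzero vector orthogonal to \<open>N\<close>. Distinct planes with a common point meet
      in a line.\<close>
    have "\<not> {x. v \<bullet> x = - h} \<subseteq> {x. w \<bullet> x = - k}"
    proof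
      assume "{x. v \<bullet> x = - h} \<subseteq> {x. w \<bullet> x = - k}"
      from plane_subset_plane_imp_proportional[OF v this]
      obtain t where "w = t *\<^sub>R v" "- k = t * - h" by blast
      then have "M = t *\<^sub>R N" by (simp add: hv kw)
      then show False using M(1,4) by simp
    qed
    moreover have "?C \<noteq> {}" using sub X0 by blast
    ultimately have "aff_dim ?C = 1"
      using v by (simp add: aff_dim_affine_Int_hyperplane affine_hyperplane aff_dim_hyperplane)
    then have "straight_line ?C"
      by (simp add: straight_line_def affine_Int affine_hyperplane)
    then show ?thesis using sub by blast
  next
    case False
    define z where "z = (- 1 / (k + l)) *\<^sub>R w"
    have "norm (u - z) = sqrt (z \<bullet> z - (k - l) / (k + l))" if u: "u \<in> ?U" for u
    proof -
      have wz: "w = (- (k + l)) *\<^sub>R z" using False by (simp add: z_def del: minus_add_distrib)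
      have "(k + l) * (u \<bullet> u) - 2 * ((k + l) * (z \<bullet> u)) + (k - l) = 0"
        using sph[OF u] by (subst (asm) wz) (simp add: algebra_simps)
      then have "u \<bullet> u - 2 * (z \<bullet> u) = - ((k - l) / (k + l))"
        using False by (simp add: field_simps)
      then have "(u - z) \<bullet> (u - z) = z \<bullet> z - (k - l) / (k + l)"
        by (simp add: inner_diff_left inner_diff_right inner_commute)
      then show ?thesis by (simp add: norm_eq_sqrt_inner)
    qed
    then show ?thesis using sphere_Int_plane_subset_circle_or_line[OF v plane] by blast
  qed
  then show ?thesis using S by (simp add: concircular_def)
qed

section \<open>Normalised Gram matrices\<close>

lemma mat22_nth [simp]:
  "mat22 a b c d $ 1 $ 1 = a" "mat22 a b c d $ 1 $ 2 = b"
  "mat22 a b c d $ 2 $ 1 = c" "mat22 a b c d $ 2 $ 2 = d"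
  by (simp_all add: mat22_def)

lemma matrix22_eq_iff:
  "(X :: 'a^2^2) = Y \<longleftrightarrow> X $ 1 $ 1 = Y $ 1 $ 1 \<and> X $ 1 $ 2 = Y $ 1 $ 2 \<and>
    X $ 2 $ 1 = Y $ 2 $ 1 \<and> X $ 2 $ 2 = Y $ 2 $ 2"
  by (auto simp: vec_eq_iff forall_2)

lemma conj_transpose_nth [simp]: "conj_transpose X $ i $ j = cnj (X $ j $ i)"
  by (simp add: conj_transpose_def)

lemma matrix_mult_nth_2: "((X :: 'a::semiring_1^2^2) ** Y) $ i $ j = X $ i $ 1 * Y $ 1 $ j + X $ i $ 2 * Y $ 2 $ j"
  by (simp add: matrix_matrix_mult_def sum_2)

lemma conj_transpose_mult: "conj_transpose (X ** Y) = conj_transpose Y ** conj_transpose X"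
  by (simp add: matrix22_eq_iff matrix_mult_nth_2 mult.commute)

lemma det_conj_transpose: "det (conj_transpose X) = cnj (det X)"
  by (simp add: det_2 mult.commute)

text \<open>Normalising by \<open>Re (det E)\<close> instead of the complex determinant gives a real
  scaling; for real determinants this is the flat surface.\<close>

definition gram :: "complex^2^2 \<Rightarrow> complex^2^2" where
  "gram E = (E ** conj_transpose E) /\<^sub>R Re (det E)"

lemma flat_surface_eq_gram:
  assumes "det (E p) \<in> \<real>"
  shows "flat_surface E p = gram (E p)"
proof -
  obtain r where r: "det (E p) = complex_of_real r" using assms by (auto elim: Reals_cases)
  show ?thesis
    unfolding flat_surface_def gram_def r
    by (simp add: matrix22_eq_iff scaleR_conv_of_real[where 'a = complex] divide_inverse_commute)
qed

text \<open>Before scaling, the determinant is the square of the real number \<open>det E\<close>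
  and the trace is the sum of the squared moduli of the entries.\<close>

lemma gram_in_hyperbolic_space:
  assumes "det E \<in> \<real>" "Re (det E) > 0"
  shows "gram E \<in> hyperbolic_space"
proof -
  define \<delta> where "\<delta> = Re (det E)"
  have d: "det E = complex_of_real \<delta>" and pos: "\<delta> > 0" using assms by (auto simp: \<delta>_def)
  have herm: "hermitian (gram E)"
    by (simp add: hermitian_def matrix22_eq_iff gram_def matrix_mult_nth_2 mult.commute)
  have g: "gram E = (E ** conj_transpose E) /\<^sub>R \<delta>" by (simp add: gram_def \<delta>_def)
  have "det (gram E) = det (E ** conj_transpose E) / complex_of_real (\<delta>\<^sup>2)"
    using pos by (simp add: det_2 g scaleR_conv_of_real[where 'a = complex] divide_simps
        power2_eq_square)
  also have "\<dots> = 1"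
    using pos d by (simp only: det_mul det_conj_transpose) (simp add: power2_eq_square)
  finally have det: "det (gram E) = 1" .
  have E0: "E \<noteq> 0" using pos d by (auto simp: det_2)
  have "Re (trace (gram E)) = ((cmod (E $ 1 $ 1))\<^sup>2 + (cmod (E $ 1 $ 2))\<^sup>2
      + (cmod (E $ 2 $ 1))\<^sup>2 + (cmod (E $ 2 $ 2))\<^sup>2) / \<delta>"
    by (simp only: cmod_power2)
      (simp add: trace_def sum_2 matrix_mult_nth_2 power2_eq_square distrib_left
        divide_inverse_commute g)
  also have "\<dots> > 0"
  proof (intro divide_pos_pos pos)
    have "E $ 1 $ 1 \<noteq> 0 \<or> E $ 1 $ 2 \<noteq> 0 \<or> E $ 2 $ 1 \<noteq> 0 \<or> E $ 2 $ 2 \<noteq> 0"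
      using E0 by (simp add: matrix22_eq_iff)
    then show "(cmod (E $ 1 $ 1))\<^sup>2 + (cmod (E $ 1 $ 2))\<^sup>2
      + (cmod (E $ 2 $ 1))\<^sup>2 + (cmod (E $ 2 $ 2))\<^sup>2 > 0"
      by (smt (verit) zero_le_power2 zero_less_power2 zero_less_norm_iff norm_eq_zero power_eq_0_iff)
  qed
  finally show ?thesis using herm det by (simp add: hyperbolic_space_def)
qed

text \<open>For \<open>det E\<close> real and positive this acts on Hermitian matrices as an
  isometry of Minkowski space, moving \<open>mat 1\<close> to \<open>gram E\<close>.\<close>

definition congruence :: "complex^2^2 \<Rightarrow> complex^2^2 \<Rightarrow> complex^2^2" where
  "congruence E Y = (E ** Y ** conj_transpose E) /\<^sub>R Re (det E)"

lemma linear_congruence: "linear (congruence E)"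
  by (rule linearI) (simp_all add: congruence_def matrix22_eq_iff matrix_mult_nth_2
      scaleR_conv_of_real[where 'a = complex] algebra_simps)

lemma gram_mult:
  assumes "det E \<in> \<real>" "det L \<in> \<real>"
  shows "gram (E ** L) = congruence E (gram L)"
proof -
  have "Re (det (E ** L)) = Re (det E) * Re (det L)"
    using assms by (auto simp: det_mul elim!: Reals_cases)
  moreover have "E ** (r *\<^sub>R Y) ** F = r *\<^sub>R (E ** Y ** F)" for r :: real and Y F :: "complex^2^2"
    by (simp add: matrix_scalar_ac scalar_matrix_assoc)
  ultimately show ?thesis
    by (simp add: gram_def congruence_def conj_transpose_mult matrix_mul_assoc)
qed

lemma gram_eq_congruence: "gram E = congruence E (mat 1)"
  by (simp add: gram_def congruence_def)

text \<open>Moves the base point to \<open>mat 1\<close>: the real linear map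
  \<open>congruence E\<close> sends \<open>gram L - mat 1\<close> to
  \<open>gram (E ** L) - gram E\<close>, hence preserves coplanarity.\<close>

lemma concircular_gram_mult:
  assumes E: "det E \<in> \<real>" "Re (det E) > 0"
    and \<L>: "\<And>L. L \<in> \<L> \<Longrightarrow> det L \<in> \<real> \<and> Re (det L) > 0"
    and one: "mat 1 \<in> \<L>"
    and span: "\<And>L. L \<in> \<L> \<Longrightarrow> gram L - mat 1 \<in> span {P, Q}"
  shows "concircular ((\<lambda>L. gram (E ** L)) ` \<L>)"
proof (rule concircular_if_coplanar)
  show "(\<lambda>L. gram (E ** L)) ` \<L> \<subseteq> hyperbolic_space"
  proof safe
    fix L assume L: "L \<in> \<L>"
    have "det (E ** L) = complex_of_real (Re (det E) * Re (det L))"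
      using E \<L>[OF L] by (simp only: det_mul of_real_mult of_real_Re)
    then show "gram (E ** L) \<in> hyperbolic_space"
      using E(2) \<L>[OF L] by (intro gram_in_hyperbolic_space) (simp_all del: of_real_mult)
  qed
  show "gram E \<in> (\<lambda>L. gram (E ** L)) ` \<L>" using one by (force simp: image_iff)
  show "X - gram E \<in> span {congruence E P, congruence E Q}"
    if X: "X \<in> (\<lambda>L. gram (E ** L)) ` \<L>" for X
  proof -
    obtain L where L: "L \<in> \<L>" "X = gram (E ** L)" using X by blast
    have "X - gram E = congruence E (gram L - mat 1)"
      using E \<L>[OF L(1)] L(2)
      by (simp add: gram_mult gram_eq_congruence[of E] linear_diff[OF linear_congruence])
    also have "\<dots> \<in> span (congruence E ` {P, Q})"
      using span[OF L(1)] linear_span_image[OF linear_congruence] by blast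
    finally show ?thesis by simp
  qed
qed

section \<open>The transition matrices of a flat lift\<close>

definition trans_mat :: "complex \<Rightarrow> real \<Rightarrow> complex^2^2" where
  "trans_mat a A = mat22 1 a (complex_of_real A / a) 1"

definition edge_dir :: "complex \<Rightarrow> real \<Rightarrow> complex^2^2" where
  "edge_dir a A = mat22 (a * cnj a) a (cnj a) (complex_of_real A)"

lemma det_trans_mat: "a \<noteq> 0 \<Longrightarrow> det (trans_mat a A) = complex_of_real (1 - A)"
  by (simp add: det_2 trans_mat_def)

lemma flat_lift_step:
  assumes "flat_lift D g \<alpha> lam E" "dir_edge D p q"
  shows "E q = E p ** trans_mat (g q - g p) (lam * \<alpha> {p, q})"
proof -
  have "E q = E p + E p ** mat22 0 (g q - g p) (complex_of_real (lam * \<alpha> {p, q}) / (g q - g p)) 0"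
    using assms unfolding flat_lift_def by (metis add.commute diff_add_cancel)
  also have "\<dots> = E p ** trans_mat (g q - g p) (lam * \<alpha> {p, q})"
    by (simp add: trans_mat_def matrix22_eq_iff matrix_mult_nth_2 algebra_simps)
  finally show ?thesis .
qed

text \<open>The off-diagonal entry \<open>a + A / cnj a\<close> equals
  \<open>(1 + A / |a|^2) a\<close>, which dictates the coefficient of \<open>edge_dir\<close>; what
  remains on the diagonal is \<open>1 - A\<close>, the determinant of
  \<open>trans_mat a A\<close>.\<close>

lemma trans_mat_gram:
  assumes a: "a \<noteq> 0"
  shows "trans_mat a A ** conj_transpose (trans_mat a A)
    = (1 - A) *\<^sub>R mat 1 + (1 + A / (cmod a)\<^sup>2) *\<^sub>R edge_dir a A"
  using a by (simp add: matrix22_eq_iff matrix_mult_nth_2 trans_mat_def edge_dir_def mat_def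
      scaleR_conv_of_real[where 'a = complex] complex_norm_square field_simps del: of_real_power)

text \<open>With \<open>a'\<close>, \<open>c'\<close>, \<open>b'\<close> standing for the conjugates of \<open>a\<close>, \<open>c\<close>, \<open>b\<close>, these are the four entries
  of the identity in \<open>trans_mat_mult_gram\<close> below; \<open>x\<close> and \<open>y\<close> are found by comparing the
  coefficients of \<open>a\<close> and \<open>c\<close> in the off-diagonal entries.\<close>

lemma trans_mat_mult_gram_entries:
  fixes a c a' c' A B x y b b' :: "'a::field"
  assumes nz: "a \<noteq> 0" "c \<noteq> 0" "a' \<noteq> 0" "c' \<noteq> 0" "B - A \<noteq> 0" "B \<noteq> 0"
    and w: "a * B + A * c \<noteq> 0" and w': "a' * B + A * c' \<noteq> 0"
    and b: "b = a * B * (a + c) / (a * B + A * c)"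
    and b': "b' = a' * B * (a' + c') / (a' * B + A * c')"
    and x: "x = (B - 1) * (A * (c * c') * ((a + c) * (a' + c'))
      + (a * B + A * c) * (a' * B + A * c')) / ((c * c') * (a * a') * (B - A))"
    and y: "y = (1 - A) * (c * c' + B) * ((a * B + A * c) * (a' * B + A * c'))
      / ((c * c') * (a * a') * B * (B - A))"
  shows "(1 + a * (B / c)) * (1 + a' * (B / c')) + (a + c) * (a' + c')
      = (1 - A) * (1 - B) + x * (a * a') + y * (b * b')" (is ?e11)
    and "(1 + a * (B / c)) * (A / a' + B / c') + (a + c) * (A / a' * c' + 1)
      = x * a + y * b" (is ?e12)
    and "(A / a + B / c) * (1 + a' * (B / c')) + (A / a * c + 1) * (a' + c')
      = x * a' + y * b'" (is ?e21)
    and "(A / a + B / c) * (A / a' + B / c') + (A / a * c + 1) * (A / a' * c' + 1)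
      = (1 - A) * (1 - B) + x * A + y * B" (is ?e22)
proof -
  define X where "X = (B - 1) * (A * (c * c') * ((a + c) * (a' + c'))
    + (a * B + A * c) * (a' * B + A * c'))"
  define Y where "Y = (1 - A) * (c * c' + B)"
  define w where "w = a * B + A * c"
  define w' where "w' = a' * B + A * c'"
  \<comment> \<open>Common denominator: \<open>x = X / D\<close> and
    \<open>y = Y w w' / (D B)\<close>. Each of the four entries is multiplied by \<open>D\<close>
    and then checked as a polynomial identity.\<close>
  define D where "D = c * c' * (a * a') * (B - A)"
  have D: "D \<noteq> 0" using nz by (simp add: D_def)
  have nzw: "w \<noteq> 0" "w' \<noteq> 0" using assms(7,8) by (simp_all add: w_def w'_def)
  have x: "D * x = X" using nz by (simp add: x X_def D_def)
  have y: "D * B * y = Y * w * w'" using nz by (simp add: y Y_def D_def w_def w'_def)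
  have b: "w * b = a * B * (a + c)" using nzw unfolding b w_def by simp
  have b': "w' * b' = a' * B * (a' + c')" using nzw unfolding b' w'_def by simp
  have yB: "D * (y * B) = Y * w * w'" using y by algebra
  \<comment> \<open>The factor \<open>B * w\<close> makes this a polynomial consequence of the
    equations for \<open>y\<close> and \<open>b\<close>; it is cancelled afterwards.\<close>
  have "(D * (y * b)) * (B * w) = (w' * Y * a * (a + c)) * (B * w)" using y b by algebra
  then have yb: "D * (y * b) = w' * Y * a * (a + c)" using nz nzw by simp
  have "(D * (y * b')) * (B * w') = (w * Y * a' * (a' + c')) * (B * w')" using y b' by algebra
  then have yb': "D * (y * b') = w * Y * a' * (a' + c')" using nz nzw by simp
  have "(D * (y * (b * b'))) * w' = (Y * a * a' * B * (a + c) * (a' + c')) * w'"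
    using yb b' by algebra
  then have ybb: "D * (y * (b * b')) = Y * a * a' * B * (a + c) * (a' + c')" using nzw by simp
  have "D * ((1 + a * (B / c)) * (1 + a' * (B / c')) + (a + c) * (a' + c'))
     = a * a' * (B - A) * ((c + a * B) * (c' + a' * B) + c * c' * ((a + c) * (a' + c')))"
    using nz(1-4) unfolding D_def by (simp add: field_simps)
  also have "\<dots> = D * ((1 - A) * (1 - B)) + X * (a * a') + Y * a * a' * B * (a + c) * (a' + c')"
    unfolding D_def X_def Y_def by algebra
  also have "\<dots> = D * ((1 - A) * (1 - B) + x * (a * a') + y * (b * b'))"
    unfolding x[symmetric] ybb[symmetric] by (simp add: algebra_simps)
  finally show ?e11 using D by simp
  have "D * ((1 + a * (B / c)) * (A / a' + B / c') + (a + c) * (A / a' * c' + 1))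
     = a * (B - A) * ((c + a * B) * (A * c' + a' * B) + c * c' * ((a + c) * (A * c' + a')))"
    using nz(1-4) unfolding D_def by (simp add: field_simps)
  also have "\<dots> = X * a + w' * Y * a * (a + c)"
    unfolding X_def Y_def w'_def by algebra
  also have "\<dots> = D * (x * a + y * b)"
    unfolding x[symmetric] yb[symmetric] by (simp add: algebra_simps)
  finally show ?e12 using D by simp
  have "D * ((A / a + B / c) * (1 + a' * (B / c')) + (A / a * c + 1) * (a' + c'))
     = a' * (B - A) * ((A * c + a * B) * (c' + a' * B) + c * c' * ((A * c + a) * (a' + c')))"
    using nz(1-4) unfolding D_def by (simp add: field_simps)
  also have "\<dots> = X * a' + w * Y * a' * (a' + c')"
    unfolding X_def Y_def w_def by algebra
  also have "\<dots> = D * (x * a' + y * b')"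
    unfolding x[symmetric] yb'[symmetric] by (simp add: algebra_simps)
  finally show ?e21 using D by simp
  have "D * ((A / a + B / c) * (A / a' + B / c') + (A / a * c + 1) * (A / a' * c' + 1))
     = (B - A) * ((A * c + a * B) * (A * c' + a' * B) + c * c' * ((A * c + a) * (A * c' + a')))"
    using nz(1-4) unfolding D_def by (simp add: field_simps)
  also have "\<dots> = D * ((1 - A) * (1 - B)) + X * A + Y * w * w'"
    unfolding D_def X_def Y_def w_def w'_def by algebra
  also have "\<dots> = D * ((1 - A) * (1 - B) + x * A + y * B)"
    unfolding x[symmetric] yB[symmetric] by (simp add: algebra_simps)
  finally show ?e22 using D by simp
qed

text \<open>In the application \<open>M\<close> leads along two edges to the opposite vertex, and
  the formula for \<open>b\<close> is the cross ratio condition solved for the other edge at the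
  base vertex. Moduli in \<open>x\<close> and \<open>y\<close> make both coefficients real.\<close>

lemma trans_mat_mult_gram:
  assumes nz: "a \<noteq> 0" "c \<noteq> 0" "A \<noteq> B" "B \<noteq> 0"
    and w: "a * B + A * c \<noteq> 0" and b: "b = a * B * (a + c) / (a * B + A * c)"
  defines "M \<equiv> trans_mat a A ** trans_mat c B"
    and "x \<equiv> (B - 1) * (A * (cmod c)\<^sup>2 * (cmod (a + c))\<^sup>2 + (cmod (a * B + A * c))\<^sup>2)
        / ((cmod c)\<^sup>2 * (cmod a)\<^sup>2 * (B - A))"
    and "y \<equiv> (1 - A) * ((cmod c)\<^sup>2 + B) * (cmod (a * B + A * c))\<^sup>2
        / ((cmod c)\<^sup>2 * (cmod a)\<^sup>2 * B * (B - A))"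
  shows "M ** conj_transpose M
    = ((1 - A) * (1 - B)) *\<^sub>R mat 1 + x *\<^sub>R edge_dir a A + y *\<^sub>R edge_dir b B"
proof -
  define a' c' where "a' = cnj a" and "c' = cnj c"
  define A' B' where "A' = complex_of_real A" and "B' = complex_of_real B"
  have nz': "a' \<noteq> 0" "c' \<noteq> 0" "B' - A' \<noteq> 0" "B' \<noteq> 0"
    and w: "a * B' + A' * c \<noteq> 0"
    using nz w by (auto simp: a'_def c'_def A'_def B'_def)
  have "cnj (a * B' + A' * c) \<noteq> 0" using w by (simp only: complex_cnj_zero_iff not_False_eq_True)
  then have w': "a' * B' + A' * c' \<noteq> 0" by (simp add: a'_def c'_def A'_def B'_def)
  have b': "cnj b = a' * B' * (a' + c') / (a' * B' + A' * c')"
    by (simp add: b a'_def c'_def A'_def B'_def)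
  have b: "b = a * B' * (a + c) / (a * B' + A' * c)"
    by (simp add: b A'_def B'_def)
  have x: "complex_of_real x = (B' - 1) * (A' * (c * c') * ((a + c) * (a' + c'))
      + (a * B' + A' * c) * (a' * B' + A' * c')) / ((c * c') * (a * a') * (B' - A'))"
    by (simp add: x_def complex_norm_square A'_def B'_def a'_def c'_def del: of_real_power)
  have y: "complex_of_real y = (1 - A') * (c * c' + B') * ((a * B' + A' * c) * (a' * B' + A' * c'))
      / ((c * c') * (a * a') * B' * (B' - A'))"
    by (simp add: y_def complex_norm_square A'_def B'_def a'_def c'_def del: of_real_power)
  note e = trans_mat_mult_gram_entries[OF nz(1,2) nz' w w' b b' x y]
  show ?thesis
    using e
    by (simp add: M_def matrix22_eq_iff matrix_mult_nth_2 trans_mat_def edge_dir_def mat_def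
        scaleR_conv_of_real[where 'a = complex] a'_def c'_def A'_def B'_def add.commute)
qed

text \<open>The coefficient of \<open>mat 1\<close> is the determinant, so after normalisation it is
  exactly 1 and cancels.\<close>

lemma gram_minus_one_in_span:
  assumes "L ** conj_transpose L = \<delta> *\<^sub>R mat 1 + x *\<^sub>R P + y *\<^sub>R Q"
    and "det L = complex_of_real \<delta>" "\<delta> \<noteq> 0"
  shows "gram L - mat 1 \<in> span {P, Q}"
proof -
  have "gram L - mat 1 = (x / \<delta>) *\<^sub>R P + (y / \<delta>) *\<^sub>R Q"
    using assms(3) by (simp add: gram_def assms(1,2) algebra_simps divide_inverse_commute)
  then show ?thesis by (simp add: span_add span_base span_scale)
qed

section \<open>The four vertices of a unit square\<close>

theorem theorem4p6:
  fixes D :: "(int \<times> int) set"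
    and g :: "int \<times> int \<Rightarrow> complex"
    and \<alpha> :: "(int \<times> int) set \<Rightarrow> real"
    and lam :: real
    and E :: "int \<times> int \<Rightarrow> complex^2^2"
    and m n :: int
  assumes "discrete_holomorphic_with D g \<alpha>"
    and "lam \<noteq> 0"
    and "flat_lift D g \<alpha> lam E"
    and "unit_square_in D m n"
  shows "concircular {flat_surface E (m, n), flat_surface E (m + 1, n),
    flat_surface E (m + 1, n + 1), flat_surface E (m, n + 1)}"
proof -
  let ?p = "(m, n)" and ?q = "(m + 1, n)" and ?r = "(m + 1, n + 1)" and ?s = "(m, n + 1)"
  define a b c where "a = g ?q - g ?p" and "b = g ?s - g ?p" and "c = g ?r - g ?q"
  define A B where "A = lam * \<alpha> {?p, ?q}" and "B = lam * \<alpha> {?p, ?s}"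
  have inD: "?p \<in> D" "?q \<in> D" "?r \<in> D" "?s \<in> D"
    using assms(4) by (auto simp: unit_square_in_def)
  have dir: "dir_edge D ?p ?q" "dir_edge D ?p ?s" "dir_edge D ?q ?r" "dir_edge D ?s ?r"
    using inD by (auto simp: dir_edge_def)
  have neq: "g ?q \<noteq> g ?p" "g ?s \<noteq> g ?p" "g ?r \<noteq> g ?q" "g ?r \<noteq> g ?s"
    using assms(1) dir unfolding discrete_holomorphic_with_def adjacent_in_def by blast+
  then have nz: "a \<noteq> 0" "b \<noteq> 0" "c \<noteq> 0" by (auto simp: a_def b_def c_def)
  have cr: "cross_ratio (g ?p) (g ?q) (g ?r) (g ?s) = complex_of_real (\<alpha> {?p, ?q} / \<alpha> {?p, ?s})"
    and neg: "\<alpha> {?p, ?q} / \<alpha> {?p, ?s} < 0" and opp: "\<alpha> {?p, ?s} = \<alpha> {?q, ?r}"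
    using assms(1,4) unfolding discrete_holomorphic_with_def cross_ratio_factorizing_def by blast+
  have AB: "A / B = \<alpha> {?p, ?q} / \<alpha> {?p, ?s}" using assms(2) by (simp add: A_def B_def)
  \<comment> \<open>A negative quotient is neither 0 nor 1; division by zero yields 0, so
    \<open>B\<close> is nonzero too.\<close>
  have AB0: "B \<noteq> 0" "A \<noteq> 0" "A \<noteq> B"
    using neg unfolding AB[symmetric] by (auto simp: divide_less_0_iff)
  have "(a * (b - (a + c))) / (c * - b) = complex_of_real A / complex_of_real B"
    using cr unfolding AB[symmetric] cross_ratio_def a_def b_def c_def by simp
  \<comment> \<open>Here \<open>a + c - b\<close> is \<open>g ?r - g ?s\<close>, so this is the
    cross ratio equation with cleared denominators.\<close>
  then have cross: "a * (a + c - b) * B = A * b * c"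
    using nz AB0 by (simp add: field_simps)
  \<comment> \<open>This allows solving \<open>cross\<close> for \<open>b\<close>: if it failed,
    \<open>cross\<close> would force \<open>c = - a\<close>, and then \<open>A = B\<close>.\<close>
  have w: "a * B + A * c \<noteq> 0"
  proof
    assume w0: "a * B + A * c = 0"
    then have "a * B * (a + c) = 0" using cross by algebra
    then have "c = - a" using nz AB0 by (simp add: add_eq_0_iff)
    then have "a * (complex_of_real B - A) = 0" using w0 by (simp add: algebra_simps)
    then show False using nz AB0 by simp
  qed
  have b: "b = a * B * (a + c) / (a * B + A * c)"
    using cross w by (simp add: field_simps)
  \<comment> \<open>\<open>?r\<close> is reached through \<open>?q\<close>; the edge from
    \<open>?q\<close> to \<open>?r\<close> carries the same \<open>B\<close> as the opposite edge
    from \<open>?p\<close> to \<open>?s\<close>.\<close>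
  have Eq: "E ?q = E ?p ** trans_mat a A" and Es: "E ?s = E ?p ** trans_mat b B"
    and Er: "E ?r = E ?p ** (trans_mat a A ** trans_mat c B)"
    using flat_lift_step[OF assms(3) dir(1)] flat_lift_step[OF assms(3) dir(2)]
      flat_lift_step[OF assms(3) dir(3)] opp
    by (simp_all add: a_def b_def c_def A_def B_def matrix_mul_assoc)
  have det: "det (E p) \<in> \<real>" "Re (det (E p)) > 0" if "p \<in> D" for p
    using assms(3) that by (auto simp: flat_lift_def)
  \<comment> \<open>\<open>det (E ?q)\<close> is \<open>1 - A\<close> times
    \<open>det (E ?p)\<close> and both are positive; likewise for \<open>1 - B\<close> and
    \<open>?s\<close>.\<close>
  have pos: "1 - A > 0" "1 - B > 0"
    using det[OF inD(1)] det[OF inD(2)] det[OF inD(4)] nz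
    by (auto simp: Eq Es det_mul det_trans_mat zero_less_mult_iff elim!: Reals_cases)
  define \<L> where "\<L> = {mat 1, trans_mat a A, trans_mat a A ** trans_mat c B, trans_mat b B}"
  have detM: "det (trans_mat a A ** trans_mat c B) = complex_of_real ((1 - A) * (1 - B))"
    using nz by (simp add: det_mul det_trans_mat)
  have "gram L - mat 1 \<in> span {edge_dir a A, edge_dir b B}" if "L \<in> \<L>" for L
  proof -
    have "gram (mat 1) = mat 1"
      by (simp add: gram_def matrix22_eq_iff matrix_mult_nth_2 mat_def det_2)
    then have "gram (mat 1) - mat 1 \<in> span {edge_dir a A, edge_dir b B}"
      by (simp add: span_zero)
    moreover have "gram (trans_mat a A) - mat 1 \<in> span {edge_dir a A, edge_dir b B}"
      using trans_mat_gram[OF nz(1), of A] det_trans_mat[OF nz(1), of A] pos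
      by (intro gram_minus_one_in_span[where y = 0]) auto
    moreover have "gram (trans_mat b B) - mat 1 \<in> span {edge_dir a A, edge_dir b B}"
      using trans_mat_gram[OF nz(2), of B] det_trans_mat[OF nz(2), of B] pos
      by (intro gram_minus_one_in_span[where x = 0]) auto
    moreover have "gram (trans_mat a A ** trans_mat c B) - mat 1 \<in> span {edge_dir a A, edge_dir b B}"
      using pos by (intro gram_minus_one_in_span[OF
            trans_mat_mult_gram[OF nz(1,3) AB0(3,1) w b] detM]) auto
    ultimately show ?thesis using that by (auto simp: \<L>_def)
  qed
  moreover have "det L \<in> \<real> \<and> Re (det L) > 0" if "L \<in> \<L>" for L
    using that pos nz by (auto simp: \<L>_def detM det_trans_mat)
  ultimately have "concircular ((\<lambda>L. gram (E ?p ** L)) ` \<L>)"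
    by (intro concircular_gram_mult det inD) (auto simp: \<L>_def)
  moreover have "(\<lambda>L. gram (E ?p ** L)) ` \<L> = {flat_surface E ?p, flat_surface E ?q,
      flat_surface E ?r, flat_surface E ?s}"
    by (simp add: \<L>_def flat_surface_eq_gram det inD flip: Eq Es Er)
  ultimately show ?thesis by simp
qed

end
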